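(* Let $U$ be a relation scheme with $n\ge 3$ attributes and truth lattices $L_A$ ($A\in U$), and let $g$ be a schema interpretation. Then $g$ is a $\wedge$-homomorphism if and only if for every $L\in\mathrm{Sb}(L_U)$, the family $g(L)=\{g(x):x\in L\}$ is a closure system over $U$.
   Context: Each attribute $A$ of $U=\{A_1,\dots,A_n\}$ has a finite lattice $L_A$ with bottom $0_A$ and top $1_A$; $L_U=\prod_{A\in U}L_A$ with componentwise order. $\mathrm{Sb}(L_U)$ is the set of subsets $L\subseteq L_U$ containing the top of $L_U$ and closed under binary meets of $L_U$. An attribute interpretation of $A$ is an increasing map $h_A:L_A\to\{0,1\}$ with $h_A(0_A)=0$, $h_A(1_A)=1$; a schema interpretation is $g(\langle x_1,\dots,x_n\rangle)=\langle h_{A_1}(x_1),\dots,h_{A_n}(x_n)\rangle\in\{0,1\}^n$, where $\{0,1\}^n$ has the componentwise order and vectors are identified with subsets of $U$. $g$ is a $\wedge$-homomorphism if $g(x\wedge y)=g(x)\wedge g(y)$ for all $x,y\in L_U$. A closure system over $U$ is a family of subsets of $U$ containing $U$ and closed under intersection. *)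

theory Defs
  imports "HOL-Algebra.Lattice" "HOL-Library.Cardinality"
begin

(* The scheme U is the universe of a finite type 'u. The lattices of the attributes may have
   different carriers, taken inside one common type 'b, so a tuple over U is a function 'u => 'b. *)

definition prod_order :: "('u \<Rightarrow> 'b gorder) \<Rightarrow> ('u \<Rightarrow> 'b) gorder"
  where "prod_order L = \<lparr>carrier = {x. \<forall>A. x A \<in> carrier (L A)}, eq = (=),
                          le = (\<lambda>x y. \<forall>A. x A \<sqsubseteq>\<^bsub>L A\<^esub> y A)\<rparr>"

(* The two-element lattice {0,1}, with False for 0 and True for 1. *)
definition two :: "bool gorder"
  where "two = \<lparr>carrier = UNIV, eq = (=), le = (\<le>)\<rparr>"

definition attribute_interpretation :: "'b gorder \<Rightarrow> ('b \<Rightarrow> bool) \<Rightarrow> bool"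
  where "attribute_interpretation L h \<longleftrightarrow> isotone L two h \<and> h \<bottom>\<^bsub>L\<^esub> = False \<and> h \<top>\<^bsub>L\<^esub> = True"

definition schema_interpretation :: "('u \<Rightarrow> 'b gorder) \<Rightarrow> (('u \<Rightarrow> 'b) \<Rightarrow> 'u \<Rightarrow> bool) \<Rightarrow> bool"
  where "schema_interpretation L g \<longleftrightarrow>
    (\<exists>h. (\<forall>A. attribute_interpretation (L A) (h A)) \<and>
         (\<forall>x\<in>carrier (prod_order L). g x = (\<lambda>A. h A (x A))))"

definition Sb :: "'b gorder \<Rightarrow> 'b set set"
  where "Sb P = {S. S \<subseteq> carrier P \<and> \<top>\<^bsub>P\<^esub> \<in> S \<and> (\<forall>x\<in>S. \<forall>y\<in>S. x \<sqinter>\<^bsub>P\<^esub> y \<in> S)}"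

definition closure_system :: "'u set \<Rightarrow> 'u set set \<Rightarrow> bool"
  where "closure_system U F \<longleftrightarrow>
    F \<subseteq> Pow U \<and> U \<in> F \<and> (\<forall>G\<subseteq>F. G \<noteq> {} \<longrightarrow> \<Inter>G \<in> F)"

definition subset_of_vector :: "('u \<Rightarrow> bool) \<Rightarrow> 'u set"
  where "subset_of_vector v = {A. v A = True}"

lemma partial_order_two: "partial_order two"
  by unfold_locales (auto simp: two_def)

lemma bounded_lattice_two: "bounded_lattice two"
proof -
  interpret partial_order two by (rule partial_order_two)
  show ?thesis
  proof unfold_locales
    fix x y :: bool
    show "\<exists>s. least two s (Upper two {x, y})"
      by (rule exI[of _ "x \<or> y"]) (auto simp: least_def Upper_def two_def)
    show "\<exists>s. greatest two s (Lower two {x, y})"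
      by (rule exI[of _ "x \<and> y"]) (auto simp: greatest_def Lower_def two_def)
  next
    show "\<exists>x. least two x (carrier two)"
      by (rule exI[of _ False]) (auto simp: least_def two_def)
    show "\<exists>x. greatest two x (carrier two)"
      by (rule exI[of _ True]) (auto simp: greatest_def two_def)
  qed
qed

lemma partial_order_prod_order:
  assumes "\<And>A. partial_order (L A)"
  shows "partial_order (prod_order L)"
proof -
  note po = partial_order.axioms(1)[OF assms]
  show ?thesis
  proof unfold_locales
    fix x y assume "x \<in> carrier (prod_order L)" "y \<in> carrier (prod_order L)"
      "x \<sqsubseteq>\<^bsub>prod_order L\<^esub> y" "y \<sqsubseteq>\<^bsub>prod_order L\<^esub> x"
    then have "x A = y A" for A
      using partial_order.le_antisym[OF assms[of A]] by (simp add: prod_order_def)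
    then show "x .=\<^bsub>prod_order L\<^esub> y" by (auto simp: prod_order_def)
  next
    fix x y z assume "x \<in> carrier (prod_order L)" "y \<in> carrier (prod_order L)"
      "z \<in> carrier (prod_order L)" "x \<sqsubseteq>\<^bsub>prod_order L\<^esub> y" "y \<sqsubseteq>\<^bsub>prod_order L\<^esub> z"
    then have "x A \<sqsubseteq>\<^bsub>L A\<^esub> z A" for A
      using weak_partial_order.le_trans[OF po[of A], of "x A" "y A" "z A"]
      by (simp add: prod_order_def)
    then show "x \<sqsubseteq>\<^bsub>prod_order L\<^esub> z" by (simp add: prod_order_def)
  qed (use weak_partial_order.le_refl[OF po] in \<open>auto simp: prod_order_def\<close>)
qed

lemma
  assumes L: "\<And>A. bounded_lattice (L A)"
  shows bounded_lattice_prod_order: "bounded_lattice (prod_order L)"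
    and top_prod_order: "\<top>\<^bsub>prod_order L\<^esub> = (\<lambda>A. \<top>\<^bsub>L A\<^esub>)"
    and meet_prod_order: "\<lbrakk>x \<in> carrier (prod_order L); y \<in> carrier (prod_order L)\<rbrakk> \<Longrightarrow>
      x \<sqinter>\<^bsub>prod_order L\<^esub> y = (\<lambda>A. x A \<sqinter>\<^bsub>L A\<^esub> y A)"
proof -
  have wb: "weak_bounded_lattice (L A)" and po: "partial_order (L A)" for A
  proof -
    interpret bounded_lattice "L A" by (rule L)
    show "weak_bounded_lattice (L A)" by unfold_locales
    show "partial_order (L A)" by unfold_locales
  qed
  interpret partial_order "prod_order L"
    by (rule partial_order_prod_order[OF po])
  note wl = weak_bounded_lattice.axioms(1)[OF wb]
  note us = weak_lattice.axioms(1)[OF wl] and ls = weak_lattice.axioms(2)[OF wl]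
  note bot = weak_partial_order_bottom.bottom_least[OF weak_bounded_lattice.axioms(2)[OF wb]]
  note top = weak_partial_order_top.top_greatest[OF weak_bounded_lattice.axioms(3)[OF wb]]
  have gt: "greatest (prod_order L) (\<lambda>A. \<top>\<^bsub>L A\<^esub>) (carrier (prod_order L))"
    using top by (auto simp: greatest_def prod_order_def)
  have lb: "least (prod_order L) (\<lambda>A. \<bottom>\<^bsub>L A\<^esub>) (carrier (prod_order L))"
    using bot by (auto simp: least_def prod_order_def)
  have gm: "greatest (prod_order L) (\<lambda>A. x A \<sqinter>\<^bsub>L A\<^esub> y A) (Lower (prod_order L) {x, y})"
    if "x \<in> carrier (prod_order L)" "y \<in> carrier (prod_order L)" for x y
    using that
    by (auto simp: greatest_def Lower_def prod_order_def
          intro: weak_lower_semilattice.meet_closed[OF ls]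
            weak_lower_semilattice.meet_left[OF ls] weak_lower_semilattice.meet_right[OF ls]
            weak_lower_semilattice.meet_le[OF ls])
  have lj: "least (prod_order L) (\<lambda>A. x A \<squnion>\<^bsub>L A\<^esub> y A) (Upper (prod_order L) {x, y})"
    if "x \<in> carrier (prod_order L)" "y \<in> carrier (prod_order L)" for x y
    using that
    by (auto simp: least_def Upper_def prod_order_def
          intro: weak_upper_semilattice.join_closed[OF us]
            weak_upper_semilattice.join_left[OF us] weak_upper_semilattice.join_right[OF us]
            weak_upper_semilattice.join_le[OF us])
  show "bounded_lattice (prod_order L)"
    by unfold_locales (use gt lb gm lj in blast)+
  show "\<top>\<^bsub>prod_order L\<^esub> = (\<lambda>A. \<top>\<^bsub>L A\<^esub>)"
    unfolding Order.top_def[of "prod_order L"] by (rule some_equality) (use gt greatest_unique in blast)+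
  show "x \<sqinter>\<^bsub>prod_order L\<^esub> y = (\<lambda>A. x A \<sqinter>\<^bsub>L A\<^esub> y A)"
    if "x \<in> carrier (prod_order L)" "y \<in> carrier (prod_order L)"
    unfolding meet_def[of "prod_order L"] Lattice.inf_def[of "prod_order L"]
    by (rule some_equality) (use gm[OF that] greatest_unique in blast)+
qed

end

(*
  Only the converse needs an idea.  If g fails to preserve meets, monotonicity gives an attribute A
  and a, b with h_A(a) = h_A(b) = 1 but h_A(a meet b) = 0.  Choose attributes B, C with A, B, C
  distinct; let x have the components a, 1, 0 at A, B, C and y the components b, 0, 1 there, both
  being 1 elsewhere.  Then S = {1, x, y, x meet y} is closed under meets, but the intersection of
  g(x) and g(y), which contains A and neither B nor C, is not attained on S: g(x) contains B,
  g(y) contains C, g(x meet y) omits A.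
*)

theory Submission
  imports Defs
begin

lemma meet_two: "x \<sqinter>\<^bsub>two\<^esub> y \<longleftrightarrow> x \<and> y"
  unfolding meet_def Lattice.inf_def
  by (rule some_equality) (auto simp: greatest_def Lower_def two_def)

lemma carrier_prod_order: "x \<in> carrier (prod_order L) \<longleftrightarrow> (\<forall>A. x A \<in> carrier (L A))"
  by (simp add: prod_order_def)

text \<open>Every Boolean vector lies in the carrier, so the componentwise formula holds without
  side conditions.\<close>

lemma meet_prod_order_two: "v \<sqinter>\<^bsub>prod_order (\<lambda>_. two)\<^esub> w = (\<lambda>A. v A \<and> w A)"
proof -
  have "v \<in> carrier (prod_order (\<lambda>_. two))" for v :: "'a \<Rightarrow> bool"
    by (simp add: prod_order_def two_def)
  then show ?thesis
    by (simp add: meet_prod_order[OF bounded_lattice_two] meet_two)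
qed

text \<open>Among these four elements only \<open>x\<close> and \<open>y\<close> can be
  incomparable, and their meet is included; any other pair is comparable, so its meet is the smaller
  member. This supplies the test family for the converse.\<close>

lemma Sb_four_elements:
  assumes "bounded_lattice P" and x: "x \<in> carrier P" and y: "y \<in> carrier P"
  shows "{\<top>\<^bsub>P\<^esub>, x, y, x \<sqinter>\<^bsub>P\<^esub> y} \<in> Sb P"
proof -
  interpret bounded_lattice P by fact
  have eq: "u \<sqinter>\<^bsub>P\<^esub> v = u" "v \<sqinter>\<^bsub>P\<^esub> u = u"
    if "u \<in> carrier P" "v \<in> carrier P" "u \<sqsubseteq>\<^bsub>P\<^esub> v" for u v
    using that le_iff_join[of u v] by (simp_all add: meet_comm[of P v u])
  show ?thesis
    using x y by (auto simp: Sb_def eq top_higher meet_left meet_right meet_comm[of P y x])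
qed

text \<open>Over a finite universe every family is finite, so binary intersections suffice by
  induction. This matches the binary meets in \<open>Sb\<close>.\<close>

lemma closure_system_UNIV_iff:
  fixes F :: "'u::finite set set"
  shows "closure_system UNIV F \<longleftrightarrow> UNIV \<in> F \<and> (\<forall>X\<in>F. \<forall>Y\<in>F. X \<inter> Y \<in> F)"
proof
  assume c: "closure_system UNIV F"
  have "X \<inter> Y \<in> F" if "X \<in> F" "Y \<in> F" for X Y
    using c that unfolding closure_system_def by (elim conjE allE[of _ "{X, Y}"]) simp
  with c show "UNIV \<in> F \<and> (\<forall>X\<in>F. \<forall>Y\<in>F. X \<inter> Y \<in> F)"
    by (auto simp: closure_system_def)
next
  assume F: "UNIV \<in> F \<and> (\<forall>X\<in>F. \<forall>Y\<in>F. X \<inter> Y \<in> F)"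
  \<comment> \<open>The base case is the empty family, whose intersection is
    \<open>UNIV\<close>.\<close>
  have "G \<subseteq> F \<Longrightarrow> \<Inter>G \<in> F" for G
    using finite[of G] by (induction G rule: finite_induct) (use F in auto)
  with F show "closure_system UNIV F" by (simp add: closure_system_def)
qed

lemma schema_interpretation_top:
  assumes "\<And>A. bounded_lattice (L A)" "schema_interpretation L g"
  shows "g \<top>\<^bsub>prod_order L\<^esub> = (\<lambda>_. True)"
proof -
  interpret P: bounded_lattice "prod_order L"
    by (rule bounded_lattice_prod_order) fact
  show ?thesis
    using assms P.top_closed
    by (auto simp: schema_interpretation_def attribute_interpretation_def top_prod_order)
qed

text \<open>Meets of Boolean vectors are intersections of the corresponding sets, so the image
  inherits closure from \<open>S\<close>, and the top of \<open>S\<close> is sent to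
  \<open>UNIV\<close>.\<close>

lemma meet_pres_imp_closure_system:
  fixes L :: "'u::finite \<Rightarrow> 'b gorder"
  assumes L: "\<And>A. bounded_lattice (L A)" and g: "schema_interpretation L g"
    and mp: "meet_pres (prod_order L) (prod_order (\<lambda>A::'u. two)) g"
    and S: "S \<in> Sb (prod_order L)"
  shows "closure_system UNIV ((\<lambda>x. subset_of_vector (g x)) ` S)"
proof -
  have "subset_of_vector (g x) \<inter> subset_of_vector (g y)
      \<in> (\<lambda>x. subset_of_vector (g x)) ` S" if "x \<in> S" "y \<in> S" for x y
  proof (rule image_eqI)
    show "x \<sqinter>\<^bsub>prod_order L\<^esub> y \<in> S"
      using S that by (simp add: Sb_def)
    have "x \<in> carrier (prod_order L)" "y \<in> carrier (prod_order L)"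
      using S that by (auto simp: Sb_def)
    then have "g (x \<sqinter>\<^bsub>prod_order L\<^esub> y) = (\<lambda>A. g x A \<and> g y A)"
      using mp by (simp add: meet_pres_def meet_prod_order_two)
    then show "subset_of_vector (g x) \<inter> subset_of_vector (g y)
        = subset_of_vector (g (x \<sqinter>\<^bsub>prod_order L\<^esub> y))"
      by (auto simp: subset_of_vector_def)
  qed
  moreover have "UNIV \<in> (\<lambda>x. subset_of_vector (g x)) ` S"
    using S schema_interpretation_top[OF L g]
    by (intro image_eqI[of _ _ "\<top>\<^bsub>prod_order L\<^esub>"]) (auto simp: Sb_def subset_of_vector_def)
  ultimately show ?thesis by (auto simp: closure_system_UNIV_iff)
qed

text \<open>The converse is localised at one attribute: meets and \<open>g\<close> act
  componentwise, so it is enough to treat each \<open>h A\<close>. Only this half of meet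
  preservation draws on the closure systems; the other half is monotonicity.\<close>

lemma closure_system_imp_attribute_meet:
  fixes L :: "'u::finite \<Rightarrow> 'b gorder"
  assumes card: "CARD('u) \<ge> 3" and L: "\<And>A. bounded_lattice (L A)"
    and h: "\<And>A. attribute_interpretation (L A) (h A)"
    and g: "\<And>x. x \<in> carrier (prod_order L) \<Longrightarrow> g x = (\<lambda>A. h A (x A))"
    and cl: "\<And>S. S \<in> Sb (prod_order L) \<Longrightarrow>
      closure_system UNIV ((\<lambda>x. subset_of_vector (g x)) ` S)"
    and ab: "a \<in> carrier (L A)" "b \<in> carrier (L A)" "h A a" "h A b"
  shows "h A (a \<sqinter>\<^bsub>L A\<^esub> b)"
proof (rule ccontr)
  assume neg: "\<not> h A (a \<sqinter>\<^bsub>L A\<^esub> b)"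
  have "\<not> UNIV \<subseteq> {A}"
    using card card_mono[of "{A}" UNIV] by auto
  then obtain B where B: "B \<noteq> A" by blast
  have "\<not> UNIV \<subseteq> {A, B}"
    using B card card_mono[of "{A, B}" UNIV] by auto
  then obtain C where C: "C \<noteq> A" "C \<noteq> B" by blast
  interpret P: bounded_lattice "prod_order L"
    by (rule bounded_lattice_prod_order[OF L])
  have bt: "\<bottom>\<^bsub>L D\<^esub> \<in> carrier (L D)" "\<top>\<^bsub>L D\<^esub> \<in> carrier (L D)"
    "\<not> h D \<bottom>\<^bsub>L D\<^esub>" "h D \<top>\<^bsub>L D\<^esub>" for D
  proof -
    interpret bounded_lattice "L D" by (rule L)
    show "\<bottom>\<^bsub>L D\<^esub> \<in> carrier (L D)" "\<top>\<^bsub>L D\<^esub> \<in> carrier (L D)"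
      by simp_all
    show "\<not> h D \<bottom>\<^bsub>L D\<^esub>" "h D \<top>\<^bsub>L D\<^esub>"
      using h[of D] by (simp_all add: attribute_interpretation_def)
  qed
  define x where "x = (\<lambda>D. \<top>\<^bsub>L D\<^esub>)(A := a, C := \<bottom>\<^bsub>L C\<^esub>)"
  define y where "y = (\<lambda>D. \<top>\<^bsub>L D\<^esub>)(A := b, B := \<bottom>\<^bsub>L B\<^esub>)"
  define m where "m = x \<sqinter>\<^bsub>prod_order L\<^esub> y"
  have x: "x \<in> carrier (prod_order L)" and y: "y \<in> carrier (prod_order L)"
    using ab bt by (auto simp: x_def y_def carrier_prod_order)
  have m: "m \<in> carrier (prod_order L)"
    using x y by (simp add: m_def)
  have "m A = a \<sqinter>\<^bsub>L A\<^esub> b"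
    \<comment> \<open>The meet is split into components while \<open>x\<close> and \<open>y\<close>
      are still folded, so that their carrier facts apply.\<close>
    using B C by (simp add: m_def meet_prod_order[OF L x y]) (simp add: x_def y_def)
  then have gm: "\<not> g m A"
    using neg by (simp add: g[OF m])
  have gx: "g x A" "g x B" "\<not> g x C" and gy: "g y A" "\<not> g y B" "g y C"
    using B C ab bt by (simp_all only: g[OF x] g[OF y]) (auto simp: x_def y_def)
  let ?F = "(\<lambda>x. subset_of_vector (g x)) ` {\<top>\<^bsub>prod_order L\<^esub>, x, y, m}"
  have "closure_system UNIV ?F"
    unfolding m_def by (rule cl, rule Sb_four_elements[OF _ x y]) unfold_locales
  then have "subset_of_vector (g x) \<inter> subset_of_vector (g y) \<in> ?F"
    unfolding closure_system_UNIV_iff by blast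
  then obtain z where z: "z \<in> {\<top>\<^bsub>prod_order L\<^esub>, x, y, m}"
    and eq: "subset_of_vector (g x) \<inter> subset_of_vector (g y) = subset_of_vector (g z)"
    by blast
  have gz: "g z D \<longleftrightarrow> g x D \<and> g y D" for D
    using arg_cong[where f = "\<lambda>X. D \<in> X", OF eq] by (simp add: subset_of_vector_def)
  \<comment> \<open>The top and \<open>x\<close> are ruled out as values of \<open>z\<close> at
    \<open>B\<close>, \<open>y\<close> at \<open>C\<close>, and \<open>m\<close> at
    \<open>A\<close>.\<close>
  have "g \<top>\<^bsub>prod_order L\<^esub> B"
    using g[OF P.top_closed] by (simp add: bt top_prod_order[OF L])
  then show False
    using z gz[of A] gz[of B] gz[of C] gx gy gm by auto
qed

theorem theorem1:
  fixes L :: "'u::finite \<Rightarrow> 'b gorder"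
    and g :: "('u \<Rightarrow> 'b) \<Rightarrow> ('u \<Rightarrow> bool)"
  assumes "CARD('u) \<ge> 3"
    and "\<And>A. bounded_lattice (L A)"
    and "\<And>A. finite (carrier (L A))"
    and "schema_interpretation L g"
  shows "meet_pres (prod_order L) (prod_order (\<lambda>A::'u. two)) g \<longleftrightarrow>
    (\<forall>S\<in>Sb (prod_order L). closure_system (UNIV :: 'u set) ((\<lambda>x. subset_of_vector (g x)) ` S))"
proof
  assume "meet_pres (prod_order L) (prod_order (\<lambda>A::'u. two)) g"
  then show "\<forall>S\<in>Sb (prod_order L). closure_system UNIV ((\<lambda>x. subset_of_vector (g x)) ` S)"
    using meet_pres_imp_closure_system[OF assms(2,4)] by blast
next
  assume cl: "\<forall>S\<in>Sb (prod_order L). closure_system UNIV ((\<lambda>x. subset_of_vector (g x)) ` S)"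
  obtain h where h: "\<And>A. attribute_interpretation (L A) (h A)"
    and g: "\<And>x. x \<in> carrier (prod_order L) \<Longrightarrow> g x = (\<lambda>A. h A (x A))"
    using assms(4) by (auto simp: schema_interpretation_def)
  interpret P: bounded_lattice "prod_order L"
    by (rule bounded_lattice_prod_order[OF assms(2)])
  \<comment> \<open>\<open>meet_pres\<close> also asserts that source and target are lattices, hence
    both interpretations.\<close>
  interpret T: bounded_lattice "prod_order (\<lambda>A::'u. two)"
    by (rule bounded_lattice_prod_order[OF bounded_lattice_two])
  have hm: "h A (a \<sqinter>\<^bsub>L A\<^esub> b) \<longleftrightarrow> h A a \<and> h A b"
    if ab: "a \<in> carrier (L A)" "b \<in> carrier (L A)" for A a b
  proof
    interpret bounded_lattice "L A" by (rule assms(2))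
    have "h A u \<longrightarrow> h A v"
      if "u \<in> carrier (L A)" "v \<in> carrier (L A)" "u \<sqsubseteq>\<^bsub>L A\<^esub> v" for u v
      using h[of A] that by (auto simp: attribute_interpretation_def isotone_def two_def)
    then show "h A (a \<sqinter>\<^bsub>L A\<^esub> b) \<Longrightarrow> h A a \<and> h A b"
      using ab meet_left meet_right meet_closed by blast
  next
    show "h A a \<and> h A b \<Longrightarrow> h A (a \<sqinter>\<^bsub>L A\<^esub> b)"
      using closure_system_imp_attribute_meet[where g = g, OF assms(1,2) h g] cl ab by blast
  qed
  have "g (x \<sqinter>\<^bsub>prod_order L\<^esub> y) = g x \<sqinter>\<^bsub>prod_order (\<lambda>A::'u. two)\<^esub> g y"
    if xy: "x \<in> carrier (prod_order L)" "y \<in> carrier (prod_order L)" for x y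
    using xy hm
    \<comment> \<open>First \<open>g\<close> is evaluated at the meet, whose membership in the
      carrier is known from \<open>P\<close>; only then is the meet expanded, leaving
      \<open>hm\<close> at each attribute.\<close>
    by (simp add: g meet_prod_order_two) (simp add: meet_prod_order[OF assms(2)] carrier_prod_order)
  then show "meet_pres (prod_order L) (prod_order (\<lambda>A::'u. two)) g"
    unfolding meet_pres_def using P.lattice_axioms T.lattice_axioms by blast
qed

end
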